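(* Let $H$ be a finite-dimensional real Hilbert space, $A, B : H \to H$ constant linear operators, $m \ge 1$, and $a_i > 0$, $b_i > 0$ for $i=1,\ldots,m$. Let $\boldsymbol{H} = H \oplus \cdots \oplus H$ ($m+1$ copies), and let $\boldsymbol{A}, \boldsymbol{B}: \boldsymbol{H} \to \boldsymbol{H}$ be the operator matrices $$\boldsymbol{B} = \mathrm{diag}(I, a_1 B, \ldots, a_m B), \qquad \boldsymbol{A} = \begin{pmatrix} A & a_1 B & \cdots & a_m B \\ -a_1 B & a_1 b_1 B & \cdots & 0 \\ \vdots & \vdots & \ddots & \vdots \\ -a_m B & 0 & \cdots & a_m b_m B \end{pmatrix}.$$ Assume that $\boldsymbol{B} = \boldsymbol{B}^* > 0$ and $\boldsymbol{A} \ge 0$. Let $u^0 \in H$ and $\boldsymbol{u}^0 = \{u^0, 0, \ldots, 0\} \in \boldsymbol{H}$. Consider the two-level scheme with constant weight $\sigma$ and time step $\tau > 0$, $$\boldsymbol{B}\, \frac{\boldsymbol{y}^{n+1} - \boldsymbol{y}^n}{\tau} + \boldsymbol{A}\big(\sigma \boldsymbol{y}^{n+1} + (1-\sigma)\boldsymbol{y}^n\big) = 0, \quad n = 0,1,\ldots,N-1, \qquad \boldsymbol{y}^0 = \boldsymbol{u}^0.$$ If $\sigma \ge 1/2$, then the scheme is unconditionally stable: for every $\tau > 0$ and every $N \ge 1$, any solution $\boldsymbol{y}^0,\ldots,\boldsymbol{y}^N \in \boldsymbol{H}$ of the scheme satisfies $$\|\boldsymbol{y}^{n+1}\|_{\boldsymbol{B}}^2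 \le \|\boldsymbol{u}^0\|^2, \qquad n = 0,1,\ldots,N-1.$$
   Context: In $\boldsymbol{H}$, for $\boldsymbol{u} = \{u,u_1,\ldots,u_m\}$ and $\boldsymbol{v} = \{v,v_1,\ldots,v_m\}$, the inner product is $(\boldsymbol{u},\boldsymbol{v}) = (u,v) + \sum_{i=1}^m (u_i,v_i)$ and $\|\boldsymbol{u}\| = (\boldsymbol{u},\boldsymbol{u})^{1/2}$. For a (not necessarily self-adjoint) operator, $\boldsymbol{A} \ge 0$ means $(\boldsymbol{A}\boldsymbol{v},\boldsymbol{v}) \ge 0$ for all $\boldsymbol{v}$; $\boldsymbol{B} > 0$ means $(\boldsymbol{B}\boldsymbol{v},\boldsymbol{v}) > 0$ for all $\boldsymbol{v} \ne 0$. For $\boldsymbol{B} = \boldsymbol{B}^* > 0$, $\|\boldsymbol{v}\|_{\boldsymbol{B}} = (\boldsymbol{B}\boldsymbol{v},\boldsymbol{v})^{1/2}$. "Unconditionally stable" means that the stated estimate holds with no restriction on the time step $\tau > 0$. *)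

theory Defs
  imports "HOL-Analysis.Analysis"
begin

text \<open>
  The direct sum of \<open>m + 1\<close> copies of \<open>H = 'a\<close> is the type \<open>'a \<times> ('a ^ 'm)\<close> with
  \<open>m = CARD('m)\<close>; its library inner product is \<open>(u,v) + (\<Sum>i. (u\<^sub>i,v\<^sub>i))\<close>.
\<close>

definition op_B :: "('a::real_inner \<Rightarrow> 'a) \<Rightarrow> ('m::finite \<Rightarrow> real) \<Rightarrow> 'a \<times> ('a ^ 'm) \<Rightarrow> 'a \<times> ('a ^ 'm)"
  where "op_B B a = (\<lambda>(v\<^sub>0, v). (v\<^sub>0, \<chi> i. a i *\<^sub>R B (v $ i)))"

definition op_A :: "('a::real_inner \<Rightarrow> 'a) \<Rightarrow> ('a \<Rightarrow> 'a) \<Rightarrow> ('m::finite \<Rightarrow> real) \<Rightarrow> ('m \<Rightarrow> real)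
    \<Rightarrow> 'a \<times> ('a ^ 'm) \<Rightarrow> 'a \<times> ('a ^ 'm)"
  where "op_A A B a b = (\<lambda>(v\<^sub>0, v).
    (A v\<^sub>0 + (\<Sum>i\<in>UNIV. a i *\<^sub>R B (v $ i)),
     \<chi> i. - (a i *\<^sub>R B v\<^sub>0) + (a i * b i) *\<^sub>R B (v $ i)))"

text \<open>Neither predicate includes self-adjointness.\<close>

definition op_nonneg :: "('v::real_inner \<Rightarrow> 'v) \<Rightarrow> bool"
  where "op_nonneg T \<longleftrightarrow> (\<forall>v. T v \<bullet> v \<ge> 0)"

definition op_pos :: "('v::real_inner \<Rightarrow> 'v) \<Rightarrow> bool"
  where "op_pos T \<longleftrightarrow> (\<forall>v. v \<noteq> 0 \<longrightarrow> T v \<bullet> v > 0)"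

definition op_norm :: "('v::real_inner \<Rightarrow> 'v) \<Rightarrow> 'v \<Rightarrow> real"
  where "op_norm T v = sqrt (T v \<bullet> v)"

definition two_level_solution ::
  "('v::real_vector \<Rightarrow> 'v) \<Rightarrow> ('v \<Rightarrow> 'v) \<Rightarrow> real \<Rightarrow> real \<Rightarrow> nat \<Rightarrow> 'v \<Rightarrow> (nat \<Rightarrow> 'v) \<Rightarrow> bool"
  where "two_level_solution BB AA \<sigma> \<tau> N w y \<longleftrightarrow>
    y 0 = w \<and>
    (\<forall>n<N. BB ((y (Suc n) - y n) /\<^sub>R \<tau>) + AA (\<sigma> *\<^sub>R y (Suc n) + (1 - \<sigma>) *\<^sub>R y n) = 0)"

end

theory Submission
  imports Defs
begin

text \<open>
  Pair the scheme with the weighted average \<open>w = \<sigma> y\<^sup>+ + (1 - \<sigma>) y = (y\<^sup>+ + y) / 2 + (\<sigma> - 1/2) d\<close>,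
  where \<open>d = y\<^sup>+ - y\<close>. By symmetry of the mass operator, twice its pairing of \<open>d\<close> with \<open>w\<close> is the
  increment of the energy plus \<open>(2 \<sigma> - 1)\<close> times the energy of \<open>d\<close>, and it is nonpositive since
  the other operator is nonnegative. So the energy does not grow.

  The library operator \<open>adjoint\<close> is a Hilbert choice, so self-adjointness only yields symmetry once
  an adjoint is known to exist; for an inner product space with a finite spanning set it is
  written down in an orthogonal basis.
\<close>

lemma ex_adjoint_finite_span:
  fixes f :: "'a::real_inner \<Rightarrow> 'b::real_inner"
  assumes lin: "linear f" and fin: "finite S" and span: "span S = (UNIV :: 'a set)"
  shows "\<exists>g. \<forall>x y. f x \<bullet> y = x \<bullet> g y"
proof -
  obtain C where C: "finite C" "span C = (UNIV :: 'a set)" "pairwise orthogonal C"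
    using basis_orthogonal[OF fin] span by metis
  \<comment> \<open>An adjoint must satisfy \<open>d \<bullet> g y = f d \<bullet> y\<close>, which
    dictates the coefficients along the orthogonal set \<open>C\<close>.\<close>
  define g where "g y = (\<Sum>d\<in>C. (f d \<bullet> y / (d \<bullet> d)) *\<^sub>R d)" for y
  have "f x \<bullet> y = x \<bullet> g y" for x y
  proof -
    have basis: "f c \<bullet> y = c \<bullet> g y" if "c \<in> C" for c
    proof -
      have "c \<bullet> g y = (\<Sum>d\<in>C. if d = c then (f c \<bullet> y / (c \<bullet> c)) * (c \<bullet> c) else 0)"
        unfolding g_def inner_sum_right using C(3) that
        by (intro sum.cong) (auto simp: pairwise_def orthogonal_def)
      \<comment> \<open>\<open>C\<close> may contain 0. There the quotient is 0 by the convention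
        for division by zero, which agrees with \<open>f 0 = 0\<close>.\<close>
      also have "\<dots> = f c \<bullet> y"
        using that C(1) linear_0[OF lin] by (cases "c = 0") simp_all
      finally show ?thesis by simp
    qed
    have "linear (\<lambda>x. f x \<bullet> y)"
      by (rule linearI) (simp_all add: linear_add[OF lin] linear_scale[OF lin] inner_left_distrib)
    moreover have "linear (\<lambda>x. x \<bullet> g y)"
      by (rule linearI) (simp_all add: inner_left_distrib)
    ultimately show ?thesis
      using linear_eq_on[of "\<lambda>x. f x \<bullet> y" "\<lambda>x. x \<bullet> g y" x C] basis C(2) by simp
  qed
  then show ?thesis by blast
qed

lemma symmetric_if_self_adjoint:
  fixes f :: "'a::real_inner \<Rightarrow> 'a"
  assumes "\<exists>g. \<forall>x y. f x \<bullet> y = x \<bullet> g y" and "adjoint f = f"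
  shows "f x \<bullet> y = x \<bullet> f y"
  using someI_ex[OF assms(1)] assms(2) unfolding adjoint_def by simp

lemma linear_op_B:
  assumes "linear B"
  shows "linear (op_B B a)"
  by (rule linearI)
    (simp_all add: op_B_def case_prod_beta prod_eq_iff vec_eq_iff linear_add[OF assms]
      linear_scale[OF assms] scaleR_add_right mult.commute)

text \<open>A block diagonal operator is transposed block by block, so an adjoint on a single copy
  of the space suffices and no basis of the direct sum has to be built.\<close>

lemma ex_adjoint_op_B:
  assumes "\<exists>g. \<forall>x y. B x \<bullet> y = x \<bullet> g y"
  shows "\<exists>G. \<forall>v w. op_B B a v \<bullet> w = v \<bullet> G w"
proof -
  obtain g where "\<And>x y. B x \<bullet> y = x \<bullet> g y" using assms by blast
  then have "op_B B a v \<bullet> w = v \<bullet> op_B g a w" for v w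
    by (auto simp: op_B_def inner_vec_def split: prod.splits)
  then show ?thesis by blast
qed

lemma two_level_energy_step:
  fixes M K :: "'v::real_inner \<Rightarrow> 'v"
  assumes lin: "linear M" and sym: "\<And>x y. M x \<bullet> y = x \<bullet> M y"
    and M: "op_nonneg M" and K: "op_nonneg K" and "\<sigma> \<ge> 1 / 2" and "\<tau> > 0"
    and step: "M ((z - y) /\<^sub>R \<tau>) + K (\<sigma> *\<^sub>R z + (1 - \<sigma>) *\<^sub>R y) = 0"
  shows "M z \<bullet> z \<le> M y \<bullet> y"
proof -
  define w where "w = \<sigma> *\<^sub>R z + (1 - \<sigma>) *\<^sub>R y"
  have diff: "M (z - y) = M z - M y" by (rule linear_diff[OF lin])
  have "M (z - y) \<bullet> w / \<tau> + K w \<bullet> w = 0"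
    using arg_cong[OF step, of "\<lambda>v. v \<bullet> w"]
    by (simp add: w_def linear_scale[OF lin] inner_left_distrib divide_inverse mult.commute)
  moreover have "K w \<bullet> w \<ge> 0" using K by (simp add: op_nonneg_def)
  ultimately have "M (z - y) \<bullet> w / \<tau> \<le> 0" by simp
  \<comment> \<open>Only the sign of \<open>\<tau>\<close> matters, hence no restriction on the step
    size.\<close>
  then have "M (z - y) \<bullet> w \<le> 0" using \<open>\<tau> > 0\<close> by (simp add: divide_le_0_iff)
  \<comment> \<open>Since \<open>2 w = (z + y) + (2 \<sigma> - 1) (z - y)\<close>, symmetry cancels
    the cross terms \<open>M z \<bullet> y\<close> and \<open>M y \<bullet> z\<close>.\<close>
  moreover have "2 * (M (z - y) \<bullet> w) = M z \<bullet> z - M y \<bullet> y + (2 * \<sigma> - 1) * (M (z - y) \<bullet> (z - y))"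
    using sym[of z y]
    by (simp add: w_def diff inner_add_right inner_diff_left inner_diff_right inner_commute
        algebra_simps)
  moreover have "(2 * \<sigma> - 1) * (M (z - y) \<bullet> (z - y)) \<ge> 0"
    using M \<open>\<sigma> \<ge> 1 / 2\<close> by (simp add: op_nonneg_def)
  ultimately show ?thesis by linarith
qed

lemma two_level_energy_bound:
  fixes M K :: "'v::real_inner \<Rightarrow> 'v"
  assumes "linear M" "\<And>x y. M x \<bullet> y = x \<bullet> M y" "op_nonneg M" "op_nonneg K" "\<sigma> \<ge> 1 / 2" "\<tau> > 0"
    and sol: "two_level_solution M K \<sigma> \<tau> N w y" and "n \<le> N"
  shows "M (y n) \<bullet> y n \<le> M w \<bullet> w"
  using \<open>n \<le> N\<close>
proof (induction n)
  case 0
  then show ?case using sol by (simp add: two_level_solution_def)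
next
  case (Suc n)
  have "M (y (Suc n)) \<bullet> y (Suc n) \<le> M (y n) \<bullet> y n"
    using sol Suc.prems
    by (intro two_level_energy_step[OF assms(1-6)]) (simp add: two_level_solution_def)
  then show ?case using Suc by simp
qed

theorem theorem2:
  fixes A B :: "'a::real_inner \<Rightarrow> 'a"
    and a b :: "'m::finite \<Rightarrow> real"
    and u\<^sub>0 :: 'a
    and \<sigma> :: real
  assumes "\<exists>S :: 'a set. finite S \<and> span S = UNIV"
    and "linear A" and "linear B"
    and "\<And>i. a i > 0" and "\<And>i. b i > 0"
    and "adjoint (op_B B a) = op_B B a" and "op_pos (op_B B a)"
    and "op_nonneg (op_A A B a b)"
    and "\<sigma> \<ge> 1 / 2"
  shows "\<forall>\<tau>>0. \<forall>N\<ge>1. \<forall>y :: nat \<Rightarrow> 'a \<times> ('a ^ 'm).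
    two_level_solution (op_B B a) (op_A A B a b) \<sigma> \<tau> N (u\<^sub>0, 0) y \<longrightarrow>
    (\<forall>n<N. (op_norm (op_B B a) (y (Suc n)))\<^sup>2 \<le> (norm (u\<^sub>0, 0 :: 'a ^ 'm))\<^sup>2)"
proof (intro allI impI)
  fix \<tau> :: real and N n :: nat and y :: "nat \<Rightarrow> 'a \<times> ('a ^ 'm)"
  assume "\<tau> > 0" and sol: "two_level_solution (op_B B a) (op_A A B a b) \<sigma> \<tau> N (u\<^sub>0, 0) y"
    and "n < N"
  let ?M = "op_B B a"
  have sym: "?M v \<bullet> w = v \<bullet> ?M w" for v w
    using assms(1) ex_adjoint_finite_span[OF assms(3)]
    by (intro symmetric_if_self_adjoint ex_adjoint_op_B assms(6)) blast
  have lin: "linear ?M" by (rule linear_op_B[OF assms(3)])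
  have nonneg: "?M v \<bullet> v \<ge> 0" for v
    \<comment> \<open>Positivity speaks of nonzero vectors only. The deleted rule would split its
      quantifier over pairs, which would no longer match \<open>v\<close>.\<close>
    using assms(7) by (cases "v = 0") (simp_all add: op_pos_def less_imp_le del: split_paired_All)
  then have "op_nonneg ?M" by (simp add: op_nonneg_def)
  then have "?M (y (Suc n)) \<bullet> y (Suc n) \<le> ?M (u\<^sub>0, 0) \<bullet> (u\<^sub>0, 0)"
    using two_level_energy_bound[OF lin sym _ assms(8) assms(9) \<open>\<tau> > 0\<close> sol] \<open>n < N\<close> by simp
  \<comment> \<open>The leading block of \<open>op_B\<close> is the identity and the other
    components of the initial vector vanish, so its energy is the plain squared norm.\<close>
  also have "\<dots> = (norm (u\<^sub>0, 0 :: 'a ^ 'm))\<^sup>2"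
    by (simp add: op_B_def norm_Pair power2_norm_eq_inner)
  finally show "(op_norm ?M (y (Suc n)))\<^sup>2 \<le> (norm (u\<^sub>0, 0 :: 'a ^ 'm))\<^sup>2"
    using nonneg by (simp add: op_norm_def)
qed

end
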